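(* Let $p\in(0,1]$, $k\in[0,1]$, and let $\{\varphi_n(r)\}_{n=0}^\infty\in\mathcal F_{dec}$ with $\varphi_0(r)=1$ for all $r\in[0,1)$ and $\Phi_1(r)=\sum_{n=1}^\infty\varphi_n(r)$. Let $R$ be the minimal positive root of the equation $p=(1+k)\Phi_1(x)$, and suppose that $p\ge(1+k)\Phi_1(r)$ for all $r\in[0,R]$. Let $f(z)=h(z)+\overline{g(z)}=\sum_{n=0}^\infty a_nz^n+\overline{\sum_{n=1}^\infty b_nz^n}$ be a harmonic mapping of $\mathbb D$ (with $h,g$ analytic in $\mathbb D$) such that $h\in\mathcal B'$ and $|g'(z)|\le k|h'(z)|$ for all $z\in\mathbb D$. Then the following sharp inequality holds: $$|a_0|^p+\sum_{n=1}^\infty|a_n|\varphi_n(r)+\sum_{n=1}^\infty|b_n|\varphi_n(r)\le\|h\|_\infty\quad\text{for all } r\le R.$$ In the case when $p<(1+k)\Phi_1(x)$ for all $x$ in some interval $(R,R+\epsilon)$ with $\epsilon>0$, the number $R$ cannot be improved, i.e. it cannot be replaced by any larger number so that the inequality still holds for all such $f$.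
   Context: $\mathbb D=\{z\in\mathbb C:|z|<1\}$ and $\|h\|_\infty=\sup_{z\in\mathbb D}|h(z)|$. $\mathcal B$ is the class of all analytic functions $\omega$ in $\mathbb D$ with $|\omega(z)|\le1$ for all $z\in\mathbb D$. $\mathcal B'$ is the class of all $h(z)=\sum_{n=0}^\infty a_nz^n\in\mathcal B$ such that $|a_n|\le1-|a_0|$ for all $n\ge1$. $\mathcal F$ is the set of all sequences $\{\varphi_n(r)\}_{n=0}^\infty$ of nonnegative continuous functions on $[0,1)$ such that $\sum_{n=0}^\infty\varphi_n(r)$ converges locally uniformly with respect to $r\in[0,1)$. $\mathcal F_{dec}\subset\mathcal F$ is the subset of decreasing sequences, i.e. $\varphi_{n+1}(r)\le\varphi_n(r)$ for all $n\ge0$ and $r\in[0,1)$.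
   Formalization: As printed the bound by ‖h‖_∞ fails (h=1/2, g=0, k=0, p=1/2, φ_n=r^n); the formal theorem proves the sum is ≤1 for all f in the class, hence ≤‖h‖_∞ when ‖h‖_∞=1, and that R cannot be improved even among f with ‖h‖_∞=1. *)

theory Defs
  imports "HOL-Complex_Analysis.Complex_Analysis"
begin

abbreviation unit_disc :: "complex set" where
  "unit_disc \<equiv> ball 0 1"

abbreviation taylor_coeff :: "(complex \<Rightarrow> complex) \<Rightarrow> nat \<Rightarrow> complex" where
  "taylor_coeff h n \<equiv> fps_nth (fps_expansion h 0) n"

(* A real supremum, hence only meaningful for functions that are bounded on the disc. *)
definition disc_supnorm :: "(complex \<Rightarrow> complex) \<Rightarrow> real" where
  "disc_supnorm h = (SUP z\<in>unit_disc. norm (h z))"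

definition class_B :: "(complex \<Rightarrow> complex) set" where
  "class_B = {\<omega>. \<omega> holomorphic_on unit_disc \<and> (\<forall>z\<in>unit_disc. norm (\<omega> z) \<le> 1)}"

definition class_B' :: "(complex \<Rightarrow> complex) set" where
  "class_B' = {h \<in> class_B. \<forall>n\<ge>1. norm (taylor_coeff h n) \<le> 1 - norm (taylor_coeff h 0)}"

(* Functions on [0,1) are total functions on the reals whose values outside [0,1) are ignored. *)
definition class_F :: "(nat \<Rightarrow> real \<Rightarrow> real) set" where
  "class_F = {\<phi>.
     (\<forall>n. continuous_on {0..<1} (\<phi> n)) \<and>
     (\<forall>n. \<forall>r\<in>{0..<1}. 0 \<le> \<phi> n r) \<and>
     (\<forall>x\<in>{0..<1}. \<exists>d>0.
        uniformly_convergent_on ({0..<1} \<inter> ball x d) (\<lambda>N r. \<Sum>n<N. \<phi> n r))}"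

definition class_F_dec :: "(nat \<Rightarrow> real \<Rightarrow> real) set" where
  "class_F_dec = {\<phi> \<in> class_F. \<forall>n. \<forall>r\<in>{0..<1}. \<phi> (Suc n) r \<le> \<phi> n r}"

definition Phi1 :: "(nat \<Rightarrow> real \<Rightarrow> real) \<Rightarrow> real \<Rightarrow> real" where
  "Phi1 \<phi> r = (\<Sum>n. \<phi> (Suc n) r)"

(* R is the least solution in (0,1) of p = F x, where F is a function on [0,1). *)
definition minimal_positive_root :: "real \<Rightarrow> (real \<Rightarrow> real) \<Rightarrow> real \<Rightarrow> bool" where
  "minimal_positive_root p F R \<longleftrightarrow>
     0 < R \<and> R < 1 \<and> p = F R \<and> (\<forall>x. 0 < x \<and> x < R \<longrightarrow> p \<noteq> F x)"

(* The mappings f = h + cnj g under consideration; g 0 = 0 because the series of g starts at n = 1. *)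
definition harmonic_class ::
  "real \<Rightarrow> (complex \<Rightarrow> complex) \<Rightarrow> (complex \<Rightarrow> complex) \<Rightarrow> (complex \<Rightarrow> complex) \<Rightarrow> bool" where
  "harmonic_class k f h g \<longleftrightarrow>
     h \<in> class_B' \<and> g holomorphic_on unit_disc \<and> g 0 = 0 \<and>
     (\<forall>z\<in>unit_disc. f z = h z + cnj (g z)) \<and>
     (\<forall>z\<in>unit_disc. norm (deriv g z) \<le> k * norm (deriv h z))"

definition bohr_sum ::
  "real \<Rightarrow> (nat \<Rightarrow> real \<Rightarrow> real) \<Rightarrow> (complex \<Rightarrow> complex) \<Rightarrow> (complex \<Rightarrow> complex) \<Rightarrow> real \<Rightarrow> real" where
  "bohr_sum p \<phi> h g r =
     norm (taylor_coeff h 0) powr p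
     + (\<Sum>n. norm (taylor_coeff h (Suc n)) * \<phi> (Suc n) r)
     + (\<Sum>n. norm (taylor_coeff g (Suc n)) * \<phi> (Suc n) r)"

(* Convergence of the two series in bohr_sum, which suminf alone does not express. *)
definition bohr_summable ::
  "(nat \<Rightarrow> real \<Rightarrow> real) \<Rightarrow> (complex \<Rightarrow> complex) \<Rightarrow> (complex \<Rightarrow> complex) \<Rightarrow> real \<Rightarrow> bool" where
  "bohr_summable \<phi> h g r \<longleftrightarrow>
     summable (\<lambda>n. norm (taylor_coeff h (Suc n)) * \<phi> (Suc n) r) \<and>
     summable (\<lambda>n. norm (taylor_coeff g (Suc n)) * \<phi> (Suc n) r)"

(* The bound bohr_sum p \<phi> h g r \<le> disc_supnorm h is not homogeneous in h and fails without a
   normalization: for k = 0, p = 1/2, \<phi> n r = r ^ n (so R = 1/3), and h constantly 1/2, g = 0,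
   the left-hand side is sqrt (1/2) and the right-hand side is 1/2.  It is therefore used under
   disc_supnorm h = 1; for arbitrary h in class_B' the corresponding upper bound is 1. *)

end

theory Submission
  imports Defs
begin

text \<open>
  The upper bound rests on \<open>\<Sum>n=1..N. \<bar>b\<^sub>n\<bar> \<le> k (1 - \<bar>a\<^sub>0\<bar>) N\<close> for every \<open>N\<close>. Writing
  \<open>g' = \<omega> h'\<close> with \<open>\<bar>\<omega>\<bar> \<le> k\<close>, the first \<open>N\<close> Taylor coefficients of \<open>g'\<close> depend only on those of \<open>h'\<close>,
  so Bessel's inequality on circles dominates their square sum by that of \<open>h'\<close>
  (\<open>sum_norm_taylor_coeff_square_le\<close>). As this holds for every \<open>N\<close>, summation by parts removes the
  weights \<open>n\<^sup>2\<close> created by differentiation, and Cauchy's inequality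
  turns \<open>\<bar>a\<^sub>n\<bar> \<le> 1 - \<bar>a\<^sub>0\<bar>\<close> into the linear bound (\<open>sum_norm_taylor_coeff_le_linear\<close>). A second
  summation by parts, against the decreasing weights \<open>\<phi>\<^sub>n(r)\<close>, gives the same estimate for the
  \<open>b\<^sub>n\<close> as if \<open>\<bar>b\<^sub>n\<bar> \<le> k (1 - \<bar>a\<^sub>0\<bar>)\<close> held for each \<open>n\<close>. Hence the sum is at most
  \<open>\<bar>a\<^sub>0\<bar>\<^sup>p + (1 - \<bar>a\<^sub>0\<bar>)(1 + k) \<Phi>\<^sub>1(r) \<le> \<bar>a\<^sub>0\<bar>\<^sup>p + p (1 - \<bar>a\<^sub>0\<bar>)\<close>, which is at most \<open>1\<close> because the
  concave function \<open>x\<^sup>p\<close> lies below its tangent at \<open>1\<close>.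

  For sharpness the same tangent is nearly attained as \<open>\<bar>a\<^sub>0\<bar> \<rightarrow> 1\<close>, so what is needed is a function in the
  class with \<open>a\<^sub>0 = a\<close> near \<open>1\<close>, with \<open>\<bar>a\<^sub>n\<bar>\<close> close to \<open>1 - a\<close> for as many \<open>n\<close> as desired, and with
  supremum norm exactly \<open>1\<close>. Disc automorphisms do not qualify: their first coefficient has modulus
  \<open>1 - a\<^sup>2 > 1 - a\<close>. The function \<open>a - (1 - a) z / (1 - \<rho> z)\<close> satisfies the coefficient condition, but its
  norm may be less than \<open>1\<close>. Adding \<open>(1 - a) t z\<^sup>M\<close> with \<open>M\<close> large and even changes only one
  late coefficient and pushes the norm beyond \<open>1\<close> when \<open>t = 1\<close>, so some \<open>t\<close> in between gives norm
  \<open>1\<close> (\<open>ex_extremal_supnorm_eq_1\<close>). With \<open>g = k (h - a)\<close> the sum then exceeds \<open>1\<close> wherever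
  \<open>(1 + k) \<Phi>\<^sub>1 > p\<close> (\<open>ex_bohr_sum_gt_1\<close>).
\<close>

section \<open>Domination of Taylor coefficients in mean square\<close>

text \<open>
  The domination bounds the quotient near each zero of \<open>H\<close>, so these singularities are removable, and
  the bound \<open>k\<close> passes to the limit. Where \<open>H\<close> vanishes, so does \<open>G\<close>; this also covers \<open>H\<close> being
  identically zero, where division by \<open>0\<close> makes the quotient \<open>0\<close>.
\<close>

lemma holomorphic_quotient_bounded:
  assumes holo: "G holomorphic_on S" "H holomorphic_on S" and S: "open S"
    and le: "\<And>z. z \<in> S \<Longrightarrow> norm (G z) \<le> k * norm (H z)" and k: "0 \<le> k"
  obtains \<omega> where "\<omega> holomorphic_on S"
    and "\<And>z. z \<in> S \<Longrightarrow> norm (\<omega> z) \<le> k" and "\<And>z. z \<in> S \<Longrightarrow> G z = \<omega> z * H z"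
proof
  define q where "q = (\<lambda>z. G z / H z)"
  have q_le: "norm (q z) \<le> k" if "z \<in> S" for z
    using le[OF that] k by (cases "H z = 0") (auto simp: q_def norm_divide field_simps)
  have ana: "G analytic_on {z}" "H analytic_on {z}" if "z \<in> S" for z
    using holo S that holomorphic_on_imp_analytic_at by blast+
  have iso: "isolated_singularity_at q z" if "z \<in> S" for z
    unfolding q_def using ana[OF that]
    by (intro isolated_singularity_at_divide isolated_singularity_at_analytic not_essential_analytic)
  have near: "\<forall>\<^sub>F w in at z. norm (q w) \<le> k" if "z \<in> S" for z
    using eventually_at_in_open'[OF S that] by eventually_elim (use q_le in auto)
  have lim: "\<exists>c. q \<midarrow>z\<rightarrow> c \<and> norm c \<le> k" if "z \<in> S" for z
  proof -
    have "not_essential q z"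
      unfolding q_def using ana[OF that]
      by (intro not_essential_divide isolated_singularity_at_analytic not_essential_analytic)
    moreover have "\<not> is_pole q z"
    proof
      assume "is_pole q z"
      then have "\<forall>\<^sub>F w in at z. k + 1 \<le> norm (q w)"
        unfolding is_pole_def using filterlim_at_infinity[of 0 q "at z"] k by auto
      with near[OF that] have "\<forall>\<^sub>F w in at z. False"
        by eventually_elim auto
      then show False by simp
    qed
    ultimately obtain c where c: "q \<midarrow>z\<rightarrow> c"
      by (auto simp: not_essential_def)
    moreover have "norm c \<le> k"
      by (rule tendsto_upperbound[OF tendsto_norm[OF c] near[OF that]]) simp
    ultimately show ?thesis by blast
  qed
  show "remove_sings q holomorphic_on S"
    using lim iso remove_sings_analytic_at S
    by (metis analytic_imp_holomorphic analytic_on_analytic_at)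
  show "norm (remove_sings q z) \<le> k" if "z \<in> S" for z
    using lim[OF that] remove_sings_eqI by metis
  show "G z = remove_sings q z * H z" if "z \<in> S" for z
  proof (cases "H z = 0")
    case True
    then show ?thesis using le[OF that] by simp
  next
    case False
    then have "q analytic_on {z}"
      unfolding q_def using ana[OF that] by (intro analytic_intros) auto
    then show ?thesis using False by (simp add: q_def)
  qed
qed

text \<open>
  Cauchy's formula for the derivatives at the centre, in Fourier form: on the circle of
  radius \<open>r\<close> the factor \<open>1 / u\<^sup>n\<close> equals \<open>cnj (u\<^sup>n) / r\<^sup>2\<^sup>n\<close>.
\<close>

lemma taylor_coeff_has_integral:
  assumes F: "F holomorphic_on unit_disc" and r: "0 < r" "r < 1"
  shows "((\<lambda>x. F (circlepath 0 r x) * cnj (circlepath 0 r x ^ n)) has_integral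
           taylor_coeff F n * of_real (r ^ (2 * n))) {0..1}"
proof -
  have sub: "cball 0 r \<subseteq> unit_disc" using r by auto
  have "((\<lambda>u. F u / (u - 0) ^ Suc n) has_contour_integral
          ((2 * pi * \<i>) / fact n * (deriv ^^ n) F 0)) (circlepath 0 r)"
    using r F sub
    by (intro Cauchy_has_contour_integral_higher_derivative_circlepath
          holomorphic_on_imp_continuous_on[OF holomorphic_on_subset[OF F]]
          holomorphic_on_subset[OF F]) auto
  then have *: "((\<lambda>x. (F (circlepath 0 r x) / circlepath 0 r x ^ Suc n) *
         (2 * pi * \<i> * r * exp (2 * of_real pi * \<i> * x)))
      has_integral (2 * pi * \<i>) * taylor_coeff F n) {0..1}"
    unfolding has_contour_integral_def
    by (rule has_integral_eq[rotated, OF has_integral_eq_rhs])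
       (auto simp: vector_derivative_circlepath01 fps_expansion_def)
  have "((\<lambda>x. of_real (r ^ (2 * n)) / (2 * pi * \<i>) *
            ((F (circlepath 0 r x) / circlepath 0 r x ^ Suc n) *
            (2 * pi * \<i> * r * exp (2 * of_real pi * \<i> * x))))
      has_integral of_real (r ^ (2 * n)) / (2 * pi * \<i>) * ((2 * pi * \<i>) * taylor_coeff F n)) {0..1}"
    by (rule has_integral_mult_right[OF *])
  then show ?thesis
  proof (rule has_integral_eq[rotated, OF has_integral_eq_rhs])
    fix x :: real
    define u where "u = circlepath 0 r x"
    have u: "of_real r * exp (2 * of_real pi * \<i> * x) = u"
      by (simp add: u_def circlepath)
    have nz: "u \<noteq> 0" using r by (simp flip: u)
    have "u * cnj u = of_real (r ^ 2)"
    proof -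
      have "norm u = r" using r by (simp flip: u add: norm_mult)
      then show ?thesis by (simp add: complex_norm_square[symmetric])
    qed
    then have "u ^ n * cnj u ^ n = of_real (r ^ (2 * n))"
      by (simp add: power_mult_distrib[symmetric] power_mult)
    then show "of_real (r ^ (2 * n)) / (2 * pi * \<i>) *
          ((F (circlepath 0 r x) / circlepath 0 r x ^ Suc n) *
          (2 * pi * \<i> * r * exp (2 * of_real pi * \<i> * x)))
        = F (circlepath 0 r x) * cnj (circlepath 0 r x ^ n)"
      using nz u by (simp flip: u_def add: field_simps)
  qed (simp_all add: field_simps)
qed

lemma mean_product_with_polynomial:
  assumes F: "F holomorphic_on unit_disc" and r: "0 < r" "r < 1"
  shows "((\<lambda>x. F (circlepath 0 r x) * cnj (\<Sum>n<N. c n * circlepath 0 r x ^ n)) has_integral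
           (\<Sum>n<N. taylor_coeff F n * cnj (c n) * of_real (r ^ (2 * n)))) {0..1}"
proof -
  have "((\<lambda>x. \<Sum>n<N. cnj (c n) * (F (circlepath 0 r x) * cnj (circlepath 0 r x ^ n))) has_integral
           (\<Sum>n<N. cnj (c n) * (taylor_coeff F n * of_real (r ^ (2 * n))))) {0..1}"
    by (intro has_integral_sum has_integral_mult_right taylor_coeff_has_integral[OF F r]) auto
  then show ?thesis
    by (simp add: sum_distrib_left mult_ac)
qed

lemma taylor_coeff_polynomial:
  "taylor_coeff (\<lambda>z. \<Sum>n<N. c n * z ^ n) m = (if m < N then c m else 0)"
proof -
  have "(\<lambda>z. \<Sum>n<N. c n * z ^ n) has_fps_expansion (\<Sum>n<N. fps_const (c n) * fps_X ^ n)"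
    by (intro fps_expansion_intros)
  then have "fps_expansion (\<lambda>z. \<Sum>n<N. c n * z ^ n) 0 = (\<Sum>n<N. fps_const (c n) * fps_X ^ n)"
    by (rule fps_expansion_eqI)
  then show ?thesis
    by (simp add: fps_sum_nth fps_X_power_nth if_distrib cong: if_cong)
qed

lemma taylor_coeff_mult:
  assumes "f holomorphic_on unit_disc" "g holomorphic_on unit_disc"
  shows "taylor_coeff (\<lambda>z. f z * g z) n = (\<Sum>i=0..n. taylor_coeff f i * taylor_coeff g (n - i))"
proof -
  have "(\<lambda>z. f z * g z) has_fps_expansion fps_expansion f 0 * fps_expansion g 0"
    using assms by (intro has_fps_expansion_mult has_fps_expansion_fps_expansion[of unit_disc]) auto
  then have "fps_expansion (\<lambda>z. f z * g z) 0 = fps_expansion f 0 * fps_expansion g 0"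
    by (rule fps_expansion_eqI)
  then show ?thesis by (simp add: fps_mult_nth)
qed

text \<open>
  Replace \<open>H\<close> by its Taylor polynomial \<open>P\<close> of degree below \<open>N\<close>: the product \<open>\<omega> P\<close> still has the first
  \<open>N\<close> coefficients of \<open>G\<close>. Bessel's inequality for \<open>\<omega> P\<close> and Parseval's identity for \<open>P\<close> on the circle
  of radius \<open>r\<close>, together with \<open>\<bar>\<omega> P\<bar> \<le> k \<bar>P\<bar>\<close>, give the claim weighted by \<open>r\<^sup>2\<^sup>n\<close>; then \<open>r \<rightarrow> 1\<close>.
\<close>

lemma sum_norm_taylor_coeff_square_le:
  assumes holo: "G holomorphic_on unit_disc" "H holomorphic_on unit_disc"
    and le: "\<And>z. z \<in> unit_disc \<Longrightarrow> norm (G z) \<le> k * norm (H z)" and k: "0 \<le> k"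
  shows "(\<Sum>n<N. (norm (taylor_coeff G n))\<^sup>2) \<le> k\<^sup>2 * (\<Sum>n<N. (norm (taylor_coeff H n))\<^sup>2)"
proof -
  obtain \<omega> where \<omega>: "\<omega> holomorphic_on unit_disc"
    and \<omega>_le: "\<And>z. z \<in> unit_disc \<Longrightarrow> norm (\<omega> z) \<le> k"
    and G: "\<And>z. z \<in> unit_disc \<Longrightarrow> G z = \<omega> z * H z"
    using holomorphic_quotient_bounded[OF holo open_ball le k] by metis
  define S P where "S = (\<lambda>z. \<Sum>n<N. taylor_coeff G n * z ^ n)"
    and "P = (\<lambda>z. \<Sum>n<N. taylor_coeff H n * z ^ n)"
  have hS: "S holomorphic_on unit_disc" and hP: "P holomorphic_on unit_disc"
    unfolding S_def P_def by (intro holomorphic_intros)+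
  have hF: "(\<lambda>z. \<omega> z * P z) holomorphic_on unit_disc"
    by (intro holomorphic_intros \<omega> hP)
  have coeff_F: "taylor_coeff (\<lambda>z. \<omega> z * P z) n = taylor_coeff G n" if "n < N" for n
  proof -
    have "taylor_coeff G n = taylor_coeff (\<lambda>z. \<omega> z * H z) n"
      by (rule arg_cong[of _ _ "\<lambda>p. fps_nth p n"], rule fps_expansion_cong,
          use eventually_nhds_in_open[of unit_disc "0::complex"] in \<open>auto elim!: eventually_mono simp: G\<close>)
    also have "\<dots> = taylor_coeff (\<lambda>z. \<omega> z * P z) n"
      unfolding taylor_coeff_mult[OF \<omega> hP] taylor_coeff_mult[OF \<omega> holo(2)]
      using that by (intro sum.cong) (simp_all add: P_def taylor_coeff_polynomial)
    finally show ?thesis by simp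
  qed
  have radius: "(\<Sum>n<N. (norm (taylor_coeff G n))\<^sup>2 * r ^ (2 * n))
        \<le> k\<^sup>2 * (\<Sum>n<N. (norm (taylor_coeff H n))\<^sup>2 * r ^ (2 * n))" if r: "0 < r" "r < 1" for r
  proof -
    let ?\<gamma> = "circlepath 0 r"
    have sq: "z * cnj z = of_real ((norm z)\<^sup>2)" for z
      by (rule complex_norm_square[symmetric])
    have "((\<lambda>x. (\<omega> (?\<gamma> x) * P (?\<gamma> x)) * cnj (S (?\<gamma> x))) has_integral
          (\<Sum>n<N. taylor_coeff G n * cnj (taylor_coeff G n) * of_real (r ^ (2 * n)))) {0..1}"
      using mean_product_with_polynomial[OF hF r, of "taylor_coeff G" N]
      by (simp add: coeff_F S_def)
    from has_integral_Re[OF this]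
    have 1: "((\<lambda>x. Re ((\<omega> (?\<gamma> x) * P (?\<gamma> x)) * cnj (S (?\<gamma> x)))) has_integral
          (\<Sum>n<N. (norm (taylor_coeff G n))\<^sup>2 * r ^ (2 * n))) {0..1}"
      by (simp add: sq flip: of_real_mult of_real_power)
    have "((\<lambda>x. S (?\<gamma> x) * cnj (S (?\<gamma> x))) has_integral
          (\<Sum>n<N. taylor_coeff G n * cnj (taylor_coeff G n) * of_real (r ^ (2 * n)))) {0..1}"
      using mean_product_with_polynomial[OF hS r, of "taylor_coeff G" N]
      by (simp add: S_def taylor_coeff_polynomial)
    from has_integral_Re[OF this]
    have 2: "((\<lambda>x. (norm (S (?\<gamma> x)))\<^sup>2) has_integral
          (\<Sum>n<N. (norm (taylor_coeff G n))\<^sup>2 * r ^ (2 * n))) {0..1}"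
      by (simp add: sq flip: of_real_mult of_real_power)
    have "((\<lambda>x. P (?\<gamma> x) * cnj (P (?\<gamma> x))) has_integral
          (\<Sum>n<N. taylor_coeff H n * cnj (taylor_coeff H n) * of_real (r ^ (2 * n)))) {0..1}"
      using mean_product_with_polynomial[OF hP r, of "taylor_coeff H" N]
      by (simp add: P_def taylor_coeff_polynomial)
    from has_integral_Re[OF this]
    have 3: "((\<lambda>x. (norm (P (?\<gamma> x)))\<^sup>2) has_integral
          (\<Sum>n<N. (norm (taylor_coeff H n))\<^sup>2 * r ^ (2 * n))) {0..1}"
      by (simp add: sq flip: of_real_mult of_real_power)
    \<comment> \<open>Bessel's inequality in pointwise form: \<open>\<bar>u - s\<bar>\<^sup>2 \<ge> 0\<close> for \<open>u = \<omega> P\<close> and \<open>s = S\<close>.\<close>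
    have "2 * Re (\<omega> (?\<gamma> x) * P (?\<gamma> x) * cnj (S (?\<gamma> x))) - (norm (S (?\<gamma> x)))\<^sup>2
        \<le> k\<^sup>2 * (norm (P (?\<gamma> x)))\<^sup>2" for x
    proof -
      let ?u = "\<omega> (?\<gamma> x) * P (?\<gamma> x)"
      have "?\<gamma> x \<in> unit_disc" using r by (simp add: circlepath norm_mult)
      then have "norm ?u \<le> k * norm (P (?\<gamma> x))"
        unfolding norm_mult using \<omega>_le by (intro mult_right_mono) auto
      then have "(norm ?u)\<^sup>2 \<le> k\<^sup>2 * (norm (P (?\<gamma> x)))\<^sup>2"
        by (metis power_mono norm_ge_zero power_mult_distrib)
      moreover have "2 * Re (?u * cnj (S (?\<gamma> x))) - (norm (S (?\<gamma> x)))\<^sup>2 \<le> (norm ?u)\<^sup>2"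
      proof -
        have "0 \<le> (Re ?u - Re (S (?\<gamma> x)))\<^sup>2 + (Im ?u - Im (S (?\<gamma> x)))\<^sup>2" by simp
        then show ?thesis
          unfolding cmod_power2 by (simp add: power2_eq_square algebra_simps)
      qed
      ultimately show ?thesis by linarith
    qed
    then have "2 * (\<Sum>n<N. (norm (taylor_coeff G n))\<^sup>2 * r ^ (2 * n))
         - (\<Sum>n<N. (norm (taylor_coeff G n))\<^sup>2 * r ^ (2 * n))
       \<le> k\<^sup>2 * (\<Sum>n<N. (norm (taylor_coeff H n))\<^sup>2 * r ^ (2 * n))"
      by (intro has_integral_le[OF has_integral_diff[OF has_integral_mult_right[OF 1] 2]
                  has_integral_mult_right[OF 3]])
    then show ?thesis by linarith
  qed
  let ?f = "\<lambda>G r. \<Sum>n<N. (norm (taylor_coeff G n))\<^sup>2 * r ^ (2 * n) :: real"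
  have lim: "(?f F \<longlongrightarrow> ?f F 1) (at_left 1)" for F
    by (intro tendsto_intros)
  have "?f G 1 \<le> k\<^sup>2 * ?f H 1"
  proof (rule tendsto_le[OF _ tendsto_mult[OF tendsto_const lim] lim])
    show "\<forall>\<^sub>F r in at_left 1. ?f G r \<le> k\<^sup>2 * ?f H r"
      using eventually_at_left_real[of 0 1] by (auto elim!: eventually_mono intro!: radius)
  qed simp
  then show ?thesis by simp
qed

section \<open>Series with decreasing weights\<close>

lemma taylor_coeff_deriv: "taylor_coeff (deriv f) n = of_nat (Suc n) * taylor_coeff f (Suc n)"
  by (simp add: fps_expansion_def funpow_Suc_right del: funpow.simps of_nat_Suc)

text \<open>
  Summation by parts. The induction carries \<open>w\<^sub>N\<close> times the difference of the partial sums,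
  which is nonnegative, so that lowering the weight lowers it.
\<close>

lemma weighted_sum_mono_decreasing:
  fixes w x y :: "nat \<Rightarrow> real"
  assumes partial: "\<And>m. (\<Sum>n<m. x n) \<le> (\<Sum>n<m. y n)"
    and nonneg: "\<And>n. 0 \<le> w n" and decreasing: "\<And>n. w (Suc n) \<le> w n"
  shows "(\<Sum>n<N. w n * x n) \<le> (\<Sum>n<N. w n * y n)"
proof -
  have diff: "0 \<le> (\<Sum>n<m. y n - x n)" for m
    using partial[of m] by (simp add: sum_subtractf)
  have "w N * (\<Sum>n<N. y n - x n) \<le> (\<Sum>n<N. w n * (y n - x n))"
  proof (induction N)
    case (Suc N)
    have "w (Suc N) * (\<Sum>n<Suc N. y n - x n) \<le> w N * (\<Sum>n<Suc N. y n - x n)"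
      by (rule mult_right_mono[OF decreasing diff])
    with Suc show ?case by (simp add: distrib_left)
  qed simp
  moreover have "0 \<le> w N * (\<Sum>n<N. y n - x n)"
    using nonneg diff by simp
  ultimately show ?thesis by (simp add: right_diff_distrib sum_subtractf)
qed

text \<open>
  Each \<open>b\<^sub>n\<close> mixes all of \<open>a\<^sub>1, \<dots>, a\<^sub>n\<close>, so the bound \<open>k M\<close> is obtained on average only: the square
  sums of \<open>n b\<^sub>n\<close> and \<open>k n a\<^sub>n\<close> compare, the decreasing weight \<open>1 / n\<^sup>2\<close> cancels the
  factor from differentiation, and Cauchy's inequality passes from squares to moduli.
\<close>

lemma sum_norm_taylor_coeff_le_linear:
  assumes holo: "h holomorphic_on unit_disc" "g holomorphic_on unit_disc"
    and le: "\<And>z. z \<in> unit_disc \<Longrightarrow> norm (deriv g z) \<le> k * norm (deriv h z)" and k: "0 \<le> k"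
    and M: "\<And>n. norm (taylor_coeff h (Suc n)) \<le> M"
  shows "(\<Sum>n<N. norm (taylor_coeff g (Suc n))) \<le> k * M * real N"
proof -
  let ?a = "\<lambda>n. norm (taylor_coeff h (Suc n))" and ?b = "\<lambda>n. norm (taylor_coeff g (Suc n))"
  have M0: "0 \<le> M" using M[of 0] norm_ge_zero order_trans by blast
  have "(\<Sum>n<m. (real (Suc n) * ?b n)\<^sup>2) \<le> (\<Sum>n<m. k\<^sup>2 * (real (Suc n) * ?a n)\<^sup>2)" for m
    using sum_norm_taylor_coeff_square_le[of "deriv g" "deriv h" k m] holo le k
    by (simp add: holomorphic_deriv taylor_coeff_deriv norm_mult sum_distrib_left del: of_nat_Suc)
  then have "(\<Sum>n<N. 1 / (real (Suc n))\<^sup>2 * (real (Suc n) * ?b n)\<^sup>2)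
      \<le> (\<Sum>n<N. 1 / (real (Suc n))\<^sup>2 * (k\<^sup>2 * (real (Suc n) * ?a n)\<^sup>2))"
    by (intro weighted_sum_mono_decreasing divide_left_mono power_mono) auto
  then have "(\<Sum>n<N. (?b n)\<^sup>2) \<le> (\<Sum>n<N. k\<^sup>2 * (?a n)\<^sup>2)"
    by (simp add: power_mult_distrib del: of_nat_Suc)
  also have "\<dots> \<le> (\<Sum>n<N. k\<^sup>2 * M\<^sup>2)"
    by (intro sum_mono mult_left_mono power_mono M) auto
  finally have "(\<Sum>n<N. (?b n)\<^sup>2) * real N \<le> (k * M * real N)\<^sup>2"
    using mult_right_mono[of "\<Sum>n<N. (?b n)\<^sup>2" "real N * (k\<^sup>2 * M\<^sup>2)" "real N"]
    by (simp add: power2_eq_square mult_ac)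
  then have "(\<Sum>n<N. ?b n)\<^sup>2 \<le> (k * M * real N)\<^sup>2"
    using sum_squared_le_sum_of_squares[of ?b "{..<N}"] by simp
  then show ?thesis
    by (rule power2_le_imp_le) (use M0 k in simp)
qed

lemma decreasing_weighted_series:
  fixes x w :: "nat \<Rightarrow> real"
  assumes x: "\<And>n. 0 \<le> x n" "\<And>N. (\<Sum>n<N. x n) \<le> C * real N"
    and w: "\<And>n. 0 \<le> w n" "\<And>n. w (Suc n) \<le> w n" "summable w" and C: "0 \<le> C"
  shows "summable (\<lambda>n. x n * w n)" and "(\<Sum>n. x n * w n) \<le> C * (\<Sum>n. w n)"
proof -
  have partial: "(\<Sum>n<N. x n * w n) \<le> C * suminf w" for N
  proof -
    have "(\<Sum>n<N. w n * x n) \<le> (\<Sum>n<N. w n * C)"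
      using x w by (intro weighted_sum_mono_decreasing) (auto simp: mult.commute)
    also have "\<dots> = C * (\<Sum>n<N. w n)" by (simp add: sum_distrib_left mult.commute)
    also have "\<dots> \<le> C * suminf w"
      using w C by (intro mult_left_mono sum_le_suminf) auto
    finally show ?thesis by (simp add: mult.commute)
  qed
  show *: "summable (\<lambda>n. x n * w n)"
    using x(1) w(1) partial
    by (intro bounded_imp_summable[of _ "C * suminf w"]) (simp_all only: lessThan_Suc_atMost[symmetric] mult_nonneg_nonneg)
  show "(\<Sum>n. x n * w n) \<le> C * (\<Sum>n. w n)"
    using partial by (rule suminf_le_const[OF *])
qed

lemma class_F_summable:
  assumes "\<phi> \<in> class_F" "r \<in> {0..<1}"
  shows "summable (\<lambda>n. \<phi> n r)"
proof -
  obtain d where "d > 0" "uniformly_convergent_on ({0..<1} \<inter> ball r d) (\<lambda>N r. \<Sum>n<N. \<phi> n r)"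
    using assms unfolding class_F_def by blast
  then have "convergent (\<lambda>N. \<Sum>n<N. \<phi> n r)"
    using assms(2) by (intro uniformly_convergent_imp_convergent[of "{0..<1} \<inter> ball r d"]) auto
  then show ?thesis by (simp add: summable_iff_convergent)
qed

section \<open>The upper bound\<close>

lemma harmonic_class_series:
  assumes k: "0 \<le> k" and \<phi>: "\<phi> \<in> class_F_dec" and fhg: "harmonic_class k f h g"
    and r: "r \<in> {0..<1}"
  shows "bohr_summable \<phi> h g r"
    and "bohr_sum p \<phi> h g r
      \<le> norm (taylor_coeff h 0) powr p + (1 - norm (taylor_coeff h 0)) * ((1 + k) * Phi1 \<phi> r)"
proof -
  let ?C = "1 - norm (taylor_coeff h 0)"
  have w: "0 \<le> \<phi> (Suc n) r" "\<phi> (Suc (Suc n)) r \<le> \<phi> (Suc n) r" for n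
    using \<phi> r by (auto simp: class_F_dec_def class_F_def)
  have summ: "summable (\<lambda>n. \<phi> (Suc n) r)"
    using class_F_summable[of \<phi> r] \<phi> r by (simp add: class_F_dec_def summable_Suc_iff[of "\<lambda>n. \<phi> n r"])
  have holo: "h holomorphic_on unit_disc" "g holomorphic_on unit_disc"
    and le: "\<And>z. z \<in> unit_disc \<Longrightarrow> norm (deriv g z) \<le> k * norm (deriv h z)"
    and a: "norm (taylor_coeff h (Suc n)) \<le> ?C" for n
    using fhg by (auto simp: harmonic_class_def class_B'_def class_B_def)
  have C: "0 \<le> ?C" using a[of 0] norm_ge_zero order_trans by blast
  have "(\<Sum>n<N. norm (taylor_coeff h (Suc n))) \<le> ?C * real N" for N
    using sum_bounded_above[of "{..<N}" "\<lambda>n. norm (taylor_coeff h (Suc n))" ?C] a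
    by (simp add: mult.commute)
  note A = decreasing_weighted_series[OF norm_ge_zero this w summ C]
  have kC: "0 \<le> k * ?C" using k C by simp
  note B = decreasing_weighted_series
      [OF norm_ge_zero sum_norm_taylor_coeff_le_linear[OF holo le k a] w summ kC]
  show "bohr_summable \<phi> h g r"
    using A(1) B(1) by (simp add: bohr_summable_def)
  show "bohr_sum p \<phi> h g r
      \<le> norm (taylor_coeff h 0) powr p + ?C * ((1 + k) * Phi1 \<phi> r)"
    using A(2) B(2) by (simp add: bohr_sum_def Phi1_def algebra_simps)
qed

text \<open>
  Young's inequality with second entry \<open>1\<close>. Its strict positivity condition excludes \<open>x = 0\<close>, where
  \<open>0 powr p = 0\<close> and the claim is \<open>p \<le> 1\<close>.
\<close>

lemma powr_le_tangent_at_1: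
  fixes x p :: real
  assumes "0 \<le> x" "0 < p" "p \<le> 1"
  shows "x powr p \<le> 1 - p * (1 - x)"
proof (cases "x = 0 \<or> p = 1")
  case False
  then show ?thesis
    using Youngs_inequality_0[of p "1 - p" x 1] assms by (simp add: algebra_simps)
qed (use assms in auto)

section \<open>The extremal functions\<close>

text \<open>
  The fraction is \<open>\<Sum>n\<ge>1. \<rho>\<^sup>n\<^sup>-\<^sup>1 z\<^sup>n\<close>, so for \<open>\<rho>\<close> near \<open>1\<close> the early coefficients almost exhaust the
  admissible size \<open>1 - a\<close>; \<open>\<rho> < 1\<close> keeps the function bounded, and \<open>t\<close> is a free parameter for
  adjusting the supremum norm.
\<close>

definition extremal :: "real \<Rightarrow> real \<Rightarrow> nat \<Rightarrow> real \<Rightarrow> complex \<Rightarrow> complex" where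
  "extremal a \<rho> M t z =
     of_real a + of_real (1 - a) * (of_real t * z ^ M - z / (1 - of_real \<rho> * z))"

lemma taylor_coeff_extremal:
  assumes "0 < M"
  shows "taylor_coeff (extremal a \<rho> M t) 0 = of_real a"
    and "taylor_coeff (extremal a \<rho> M t) (Suc n)
      = of_real ((1 - a) * ((if Suc n = M then t else 0) - \<rho> ^ n))"
proof -
  let ?F = "fps_const (of_real a) + fps_const (of_real (1 - a)) *
    (fps_const (of_real t) * fps_X ^ M
      - fps_X * inverse (1 - fps_const (of_real \<rho>) * fps_X)) :: complex fps"
  have "extremal a \<rho> M t has_fps_expansion ?F"
    unfolding extremal_def [abs_def] divide_inverse
    by (intro fps_expansion_intros) auto
  then have *: "fps_expansion (extremal a \<rho> M t) 0 = ?F"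
    by (rule fps_expansion_eqI)
  have inv: "inverse (1 - fps_const c * fps_X) = Abs_fps (\<lambda>n. c ^ n)" for c :: complex
  proof (rule fps_inverse_unique)
    show "(1 - fps_const c * fps_X) * Abs_fps (\<lambda>n. c ^ n) = 1"
    proof (rule fps_ext)
      fix n
      show "((1 - fps_const c * fps_X) * Abs_fps (\<lambda>n. c ^ n)) $ n = 1 $ n"
        by (cases n) (simp_all add: left_diff_distrib mult.assoc)
    qed
  qed
  show "taylor_coeff (extremal a \<rho> M t) 0 = of_real a"
    using assms by (simp add: * inv)
  show "taylor_coeff (extremal a \<rho> M t) (Suc n)
      = of_real ((1 - a) * ((if Suc n = M then t else 0) - \<rho> ^ n))"
    by (simp add: * inv)
qed

lemma one_minus_mult_neq_0:
  assumes "0 \<le> \<rho>" "\<rho> < 1" "norm (z :: complex) < 1"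
  shows "1 - of_real \<rho> * z \<noteq> 0"
proof
  assume "1 - of_real \<rho> * z = 0"
  then have "norm (of_real \<rho> * z) = 1" by (metis eq_iff_diff_eq_0 norm_one)
  moreover have "norm (of_real \<rho> * z) < 1 * 1"
    unfolding norm_mult using assms by (intro mult_strict_mono) auto
  ultimately show False by simp
qed

lemma holomorphic_extremal:
  assumes "0 \<le> \<rho>" "\<rho> < 1"
  shows "extremal a \<rho> M t holomorphic_on unit_disc"
  unfolding extremal_def [abs_def]
  using one_minus_mult_neq_0[OF assms] by (intro holomorphic_intros) auto

text \<open>
  For \<open>t = 0\<close> the function is the Moebius map \<open>(a - u z) / (1 - \<rho> z)\<close> with \<open>u = 1 - a (1 - \<rho>) \<ge> \<rho>\<close>. The
  difference of the squared moduli of denominator and numerator decreases in \<open>\<bar>z\<bar>\<^sup>2\<close> and is affine in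
  \<open>Re z\<close>, so it suffices to check \<open>z = 1\<close> and \<open>z = -1\<close>; the former uses \<open>\<rho> \<le> a\<close>.
\<close>

lemma norm_extremal_0_le:
  assumes \<rho>: "0 \<le> \<rho>" "\<rho> < 1" and a: "\<rho> \<le> a" "a < 1" and z: "z \<in> unit_disc"
  shows "norm (extremal a \<rho> M 0 z) \<le> 1"
proof -
  define u where "u = a * \<rho> + (1 - a)"
  define x y where "x = Re z" and "y = Im z"
  have nz: "1 - of_real \<rho> * z \<noteq> 0" using one_minus_mult_neq_0[OF \<rho>] z by simp
  have eq: "extremal a \<rho> M 0 z = (of_real a - of_real u * z) / (1 - of_real \<rho> * z)"
    using nz by (simp add: extremal_def u_def field_simps)
  have q: "x\<^sup>2 + y\<^sup>2 \<le> 1"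
    using z unfolding x_def y_def cmod_power2[symmetric] by (simp add: power_le_one)
  then have "\<bar>x\<bar> \<le> 1"
    using abs_le_square_iff[of x 1] zero_le_power2[of y] by simp
  then have x: "0 \<le> 1 + x" "0 \<le> 1 - x" by linarith+
  have "u - \<rho> = (1 - a) * (1 - \<rho>)" by (simp add: u_def algebra_simps)
  then have u: "\<rho> \<le> u" using a \<rho> by (metis diff_ge_0_iff_ge less_imp_le mult_nonneg_nonneg)
  have D1: "0 \<le> (1 - \<rho>)\<^sup>2 - (a - u)\<^sup>2"
  proof -
    have "(1 - \<rho>)\<^sup>2 - (a - u)\<^sup>2 = ((1 - \<rho>) + (a - u)) * ((1 - \<rho>) - (a - u))"
      by (simp add: power2_eq_square algebra_simps)
    also have "(1 - \<rho>) - (a - u) = (2 - \<rho>) * (1 - a)" by (simp add: u_def algebra_simps)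
    also have "(1 - \<rho>) + (a - u) = (a - \<rho>) + a * (1 - \<rho>)" by (simp add: u_def algebra_simps)
    finally show ?thesis using a \<rho> by simp
  qed
  have D2: "0 \<le> (1 + \<rho>)\<^sup>2 - (a + u)\<^sup>2"
  proof -
    have "a + u = 1 + a * \<rho>" by (simp add: u_def)
    moreover have "a * \<rho> \<le> \<rho>" using a \<rho> by (simp add: mult_left_le_one_le)
    ultimately show ?thesis using a \<rho> by (simp add: power_mono)
  qed
  have "(a - u * x)\<^sup>2 + (u * y)\<^sup>2 \<le> (1 - \<rho> * x)\<^sup>2 + (\<rho> * y)\<^sup>2"
  proof -
    \<comment> \<open>Interpolation between the values at \<open>1\<close> and \<open>-1\<close>, plus the gain from \<open>\<bar>z\<bar> \<le> 1\<close>.\<close>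
    have "0 \<le> (1 + x) / 2 * ((1 - \<rho>)\<^sup>2 - (a - u)\<^sup>2) + (1 - x) / 2 * ((1 + \<rho>)\<^sup>2 - (a + u)\<^sup>2)
        + (1 - (x\<^sup>2 + y\<^sup>2)) * (u\<^sup>2 - \<rho>\<^sup>2)"
      using x D1 D2 q u \<rho> by (intro add_nonneg_nonneg mult_nonneg_nonneg) (auto simp: power_mono)
    also have "\<dots> = (1 - \<rho> * x)\<^sup>2 + (\<rho> * y)\<^sup>2 - ((a - u * x)\<^sup>2 + (u * y)\<^sup>2)"
      by (simp add: power2_eq_square field_simps)
    finally show ?thesis by simp
  qed
  then have "(norm (of_real a - of_real u * z))\<^sup>2 \<le> (norm (1 - of_real \<rho> * z))\<^sup>2"
    unfolding cmod_power2 by (simp add: x_def y_def)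
  then have "norm (of_real a - of_real u * z) \<le> norm (1 - of_real \<rho> * z)"
    by (rule power2_le_imp_le) simp
  then show ?thesis using nz by (simp add: eq norm_divide)
qed

text \<open>
  The norm is at most \<open>1\<close> for \<open>t = 0\<close> and at least \<open>1\<close> for \<open>t = 1\<close>, and it depends continuously (even
  \<open>1\<close>-Lipschitz) on \<open>t\<close>. For \<open>t = 1\<close> the points near \<open>-1\<close> decide: since \<open>M\<close> is even, both \<open>z\<^sup>M\<close> and
  \<open>- z / (1 - \<rho> z)\<close> are positive there, with sum tending to \<open>1 + 1 / (1 + \<rho>) > 1\<close>.
\<close>

lemma ex_extremal_supnorm_eq_1:
  assumes \<rho>: "0 \<le> \<rho>" "\<rho> < 1" and a: "\<rho> \<le> a" "a < 1" and M: "even M"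
  obtains t where "0 \<le> t" "t \<le> 1" "disc_supnorm (extremal a \<rho> M t) = 1"
    "\<And>z. z \<in> unit_disc \<Longrightarrow> norm (extremal a \<rho> M t z) \<le> 1"
proof -
  let ?h = "extremal a \<rho> M" and ?s = "\<lambda>t. disc_supnorm (extremal a \<rho> M t)"
  have lip: "norm (?h t z) \<le> norm (?h t' z) + \<bar>t - t'\<bar>" if "z \<in> unit_disc" for t t' z
  proof -
    have "?h t z = ?h t' z + of_real (1 - a) * (of_real (t - t') * z ^ M)"
      by (simp add: extremal_def algebra_simps)
    then have "norm (?h t z) \<le> norm (?h t' z) + norm (of_real (1 - a) * (of_real (t - t') * z ^ M))"
      by (metis norm_triangle_ineq)
    also have "norm (of_real (1 - a) * (of_real (t - t') * z ^ M)) = (1 - a) * (\<bar>t - t'\<bar> * norm z ^ M)"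
      using a by (simp only: norm_mult norm_of_real norm_power abs_of_pos diff_gt_0_iff_gt)
    also have "\<dots> \<le> 1 * (\<bar>t - t'\<bar> * 1)"
      using a \<rho> that by (intro mult_mono power_le_one) auto
    finally show ?thesis by simp
  qed
  have bdd: "bdd_above ((\<lambda>z. norm (?h t z)) ` unit_disc)" for t
  proof (rule bdd_aboveI2)
    fix z :: complex assume z: "z \<in> unit_disc"
    show "norm (?h t z) \<le> 1 + \<bar>t\<bar>"
      using lip[OF z, of t 0] norm_extremal_0_le[OF \<rho> a z, of M] by simp
  qed
  have upper: "norm (?h t z) \<le> ?s t" if "z \<in> unit_disc" for t z
    unfolding disc_supnorm_def by (rule cSUP_upper[OF that bdd])
  have s_le: "?s t \<le> ?s t' + \<bar>t - t'\<bar>" for t t'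
  proof -
    have "norm (?h t z) \<le> ?s t' + \<bar>t - t'\<bar>" if "z \<in> unit_disc" for z
      using lip[OF that, of t t'] upper[OF that, of t'] by linarith
    then show ?thesis
      unfolding disc_supnorm_def[of "?h t"] by (intro cSUP_least) auto
  qed
  have "dist (?s t') (?s t) \<le> dist t' t" for t t'
    using s_le[of t t'] s_le[of t' t] by (simp add: dist_real_def abs_le_iff abs_minus_commute)
  then have cont: "continuous_on {0..1} ?s"
    by (intro continuous_onI) (meson less_imp_le order_trans)
  have s0: "?s 0 \<le> 1"
    unfolding disc_supnorm_def using norm_extremal_0_le[OF \<rho> a] by (intro cSUP_least) auto
  have "((\<lambda>x. a + (1 - a) * (x ^ M + x / (1 + \<rho> * x))) \<longlongrightarrow>
      a + (1 - a) * (1 ^ M + 1 / (1 + \<rho> * 1))) (at_left 1)"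
    using \<rho> by (intro tendsto_intros) auto
  moreover have "1 < a + (1 - a) * (1 ^ M + 1 / (1 + \<rho> * 1))"
    using \<rho> a by (simp add: field_simps)
  ultimately have "\<forall>\<^sub>F x in at_left 1. 1 < a + (1 - a) * (x ^ M + x / (1 + \<rho> * x))"
    by (rule order_tendstoD)
  moreover have "\<forall>\<^sub>F x in at_left (1::real). x \<in> {0<..<1}"
    by (rule eventually_at_left_real) simp
  ultimately have "\<forall>\<^sub>F x in at_left (1::real).
      x \<in> {0<..<1} \<and> 1 < a + (1 - a) * (x ^ M + x / (1 + \<rho> * x))"
    by eventually_elim blast
  then obtain x :: real where x: "0 < x" "x < 1" "1 < a + (1 - a) * (x ^ M + x / (1 + \<rho> * x))"
    using eventually_happens'[OF trivial_limit_at_left_real] by force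
  have "?h 1 (- of_real x) = of_real (a + (1 - a) * (x ^ M + x / (1 + \<rho> * x)))"
    using M by (simp add: extremal_def)
  then have "1 < norm (?h 1 (- of_real x))"
    using x by (simp only: norm_of_real)
  then have s1: "1 \<le> ?s 1"
    using upper[of "- of_real x" 1] x by simp
  obtain t where "0 \<le> t" "t \<le> 1" "?s t = 1"
    using IVT'[OF s0 s1 zero_le_one cont] by auto
  then show ?thesis
    using that upper[of _ t] by auto
qed

text \<open>
  The choice \<open>g = k (h - a)\<close> attains equality in the dilatation bound. The coefficient condition
  survives the perturbation because \<open>\<bar>t - \<rho>\<^sup>n\<bar> \<le> 1\<close> for \<open>t\<close> in the unit interval.
\<close>

lemma harmonic_class_extremal:
  assumes \<rho>: "0 \<le> \<rho>" "\<rho> < 1" and a: "0 \<le> a" "a < 1" and M: "0 < M" and t: "0 \<le> t" "t \<le> 1"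
    and k: "0 \<le> k" and bound: "\<And>z. z \<in> unit_disc \<Longrightarrow> norm (extremal a \<rho> M t z) \<le> 1"
    and h_def: "h = extremal a \<rho> M t" and g_def: "g = (\<lambda>z. of_real k * (h z - of_real a))"
  shows "harmonic_class k (\<lambda>z. h z + cnj (g z)) h g"
    and "taylor_coeff g (Suc n) = of_real k * taylor_coeff h (Suc n)"
proof -
  have holo: "h holomorphic_on unit_disc"
    unfolding h_def by (rule holomorphic_extremal[OF \<rho>])
  have coeff: "norm (taylor_coeff h (Suc n)) \<le> 1 - norm (taylor_coeff h 0)" for n
  proof -
    have "\<bar>(if Suc n = M then t else 0) - \<rho> ^ n\<bar> \<le> 1"
      using t power_le_one[OF \<rho>(1) less_imp_le[OF \<rho>(2)], of n] zero_le_power[OF \<rho>(1), of n]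
      by (simp add: abs_le_iff split del: if_split) (simp split: if_split)
    then have "(1 - a) * \<bar>(if Suc n = M then t else 0) - \<rho> ^ n\<bar> \<le> (1 - a) * 1"
      using a by (intro mult_left_mono) auto
    then show ?thesis
      unfolding h_def taylor_coeff_extremal[OF M] norm_of_real abs_mult using a by simp
  qed
  have "norm (taylor_coeff h n) \<le> 1 - norm (taylor_coeff h 0)" if "1 \<le> n" for n
    using coeff[of "n - 1"] that by simp
  then have "h \<in> class_B'"
    using holo bound by (simp add: class_B'_def class_B_def h_def)
  moreover have "g 0 = 0"
    using M by (simp add: g_def h_def extremal_def)
  moreover have "g holomorphic_on unit_disc"
    unfolding g_def by (intro holomorphic_intros holo)
  moreover have "norm (deriv g z) \<le> k * norm (deriv h z)" if "z \<in> unit_disc" for z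
  proof -
    have "(h has_field_derivative deriv h z) (at z)"
      using holo that by (intro holomorphic_derivI[of h unit_disc]) auto
    then have "(g has_field_derivative of_real k * (deriv h z - 0)) (at z)"
      unfolding g_def by (rule DERIV_cmult[OF DERIV_diff[OF _ DERIV_const]])
    then show ?thesis
      using k by (simp add: DERIV_imp_deriv norm_mult)
  qed
  ultimately show "harmonic_class k (\<lambda>z. h z + cnj (g z)) h g"
    by (simp add: harmonic_class_def)
  have "g has_fps_expansion fps_const (of_real k) * (fps_expansion h 0 - fps_const (of_real a))"
    unfolding g_def using holo
    by (intro fps_expansion_intros has_fps_expansion_fps_expansion[of unit_disc]) auto
  then have "fps_expansion g 0 = fps_const (of_real k) * (fps_expansion h 0 - fps_const (of_real a))"
    by (rule fps_expansion_eqI)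
  then show "taylor_coeff g (Suc n) = of_real k * taylor_coeff h (Suc n)"
    by simp
qed

text \<open>
  The counterpart of the tangent bound from below; the error against \<open>p (1 - x)\<close> is of second order
  as \<open>x \<rightarrow> 1\<close>. It combines \<open>exp y \<ge> 1 + y\<close> with \<open>ln x \<ge> 1 - 1 / x\<close>.
\<close>

lemma tangent_le_powr:
  fixes x p :: real
  assumes "0 < x" "0 \<le> p"
  shows "1 - p * (1 - x) / x \<le> x powr p"
proof -
  have "ln (1 / x) \<le> 1 / x - 1"
    using assms by (intro ln_le_minus_one) simp
  then have "- ((1 - x) / x) \<le> ln x"
    using assms by (simp add: ln_div field_simps)
  then have "p * (- ((1 - x) / x)) \<le> p * ln x"
    using assms(2) by (rule mult_left_mono)
  also have "\<dots> \<le> exp (p * ln x) - 1"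
    using exp_ge_add_one_self[of "p * ln x"] by linarith
  finally show ?thesis using assms by (simp add: powr_def mult.commute)
qed

text \<open>
  The parameters are chosen one after the other: \<open>N\<close> so that the partial sum of \<open>\<Phi>\<^sub>1\<close> is still too
  large, then \<open>\<rho>\<close> so close to \<open>1\<close> that damping by \<open>\<rho>\<^sup>n\<close> keeps it so, giving a sum \<open>S\<close> with
  \<open>(1 + k) S > p\<close>, and finally \<open>a < 1\<close> with \<open>(1 + k) S > p / a\<close>, so that the gain
  \<open>(1 - a) (1 + k) S\<close> beats the loss \<open>1 - a\<^sup>p \<le> (1 - a) p / a\<close>.
\<close>

lemma ex_bohr_sum_gt_1:
  assumes p: "0 < p" and k: "0 \<le> k" and \<phi>: "\<phi> \<in> class_F_dec" and r: "r \<in> {0..<1}"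
    and large: "p < (1 + k) * Phi1 \<phi> r"
  shows "\<exists>f h g. harmonic_class k f h g \<and> disc_supnorm h = 1 \<and> 1 < bohr_sum p \<phi> h g r"
proof -
  have nonneg: "0 \<le> \<phi> (Suc n) r" for n
    using \<phi> r by (auto simp: class_F_dec_def class_F_def)
  have "summable (\<lambda>n. \<phi> (Suc n) r)"
    using class_F_summable[of \<phi> r] \<phi> r
    by (simp add: class_F_dec_def summable_Suc_iff[of "\<lambda>n. \<phi> n r"])
  then have "(\<lambda>N. (1 + k) * (\<Sum>n<N. \<phi> (Suc n) r)) \<longlonglongrightarrow> (1 + k) * Phi1 \<phi> r"
    unfolding Phi1_def by (intro tendsto_mult tendsto_const summable_LIMSEQ)
  from order_tendstoD(1)[OF this large]
  obtain N where N: "p < (1 + k) * (\<Sum>n<N. \<phi> (Suc n) r)"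
    by (auto simp: eventually_sequentially)
  have "((\<lambda>\<rho>. (1 + k) * (\<Sum>n<N. \<rho> ^ n * \<phi> (Suc n) r)) \<longlongrightarrow>
      (1 + k) * (\<Sum>n<N. 1 ^ n * \<phi> (Suc n) r)) (at_left 1)"
    by (intro tendsto_intros)
  then have "\<forall>\<^sub>F \<rho> in at_left 1. p < (1 + k) * (\<Sum>n<N. \<rho> ^ n * \<phi> (Suc n) r)"
    by (rule order_tendstoD) (use N in simp)
  moreover have "\<forall>\<^sub>F \<rho> in at_left (1::real). \<rho> \<in> {0<..<1}"
    by (rule eventually_at_left_real) simp
  ultimately have "\<forall>\<^sub>F \<rho> in at_left 1.
      \<rho> \<in> {0<..<1} \<and> p < (1 + k) * (\<Sum>n<N. \<rho> ^ n * \<phi> (Suc n) r)"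
    by eventually_elim blast
  then obtain \<rho> where \<rho>: "0 < \<rho>" "\<rho> < 1"
    and large_\<rho>: "p < (1 + k) * (\<Sum>n<N. \<rho> ^ n * \<phi> (Suc n) r)"
    using eventually_happens'[OF trivial_limit_at_left_real] by force
  define S where "S = (\<Sum>n<N. \<rho> ^ n * \<phi> (Suc n) r)"
  \<comment> \<open>Even, and beyond all coefficients that enter \<open>S\<close>, whose indices are at most \<open>N\<close>.\<close>
  define M where "M = 2 * N + 2"
  have S: "0 < (1 + k) * S" "p / ((1 + k) * S) < 1"
    using large_\<rho> p by (auto simp: S_def)
  obtain a where a: "max \<rho> (p / ((1 + k) * S)) < a" "a < 1"
    using dense[of "max \<rho> (p / ((1 + k) * S))" 1] \<rho> S by auto
  then have a': "0 < a" "p / a < (1 + k) * S"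
    using \<rho> S by (auto simp: field_simps)
  obtain t where t: "0 \<le> t" "t \<le> 1" "disc_supnorm (extremal a \<rho> M t) = 1"
    "\<And>z. z \<in> unit_disc \<Longrightarrow> norm (extremal a \<rho> M t z) \<le> 1"
    using ex_extremal_supnorm_eq_1[of \<rho> a M] \<rho> a by (auto simp: M_def)
  define h where "h = extremal a \<rho> M t"
  define g where "g = (\<lambda>z. complex_of_real k * (h z - of_real a))"
  have M: "0 < M" by (simp add: M_def)
  note ext = harmonic_class_extremal[OF less_imp_le[OF \<rho>(1)] \<rho>(2) less_imp_le[OF a'(1)] a(2) M
      t(1,2) k t(4) h_def g_def]
  have hc: "harmonic_class k (\<lambda>z. h z + cnj (g z)) h g"
    by (rule ext(1))
  have g_coeff: "taylor_coeff g (Suc n) = of_real k * taylor_coeff h (Suc n)" for n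
    by (rule ext(2))
  have h_coeff: "norm (taylor_coeff h (Suc n)) = (1 - a) * \<rho> ^ n" if "n < N" for n
    unfolding h_def taylor_coeff_extremal[OF M] norm_of_real
    using that a \<rho> by (simp add: M_def abs_mult)
  note summ = harmonic_class_series(1)[OF k \<phi> hc r, unfolded bohr_summable_def]
  have "(1 - a) * S = (\<Sum>n<N. norm (taylor_coeff h (Suc n)) * \<phi> (Suc n) r)"
    by (simp add: S_def sum_distrib_left h_coeff mult.assoc)
  also have "\<dots> \<le> (\<Sum>n. norm (taylor_coeff h (Suc n)) * \<phi> (Suc n) r)"
    using summ nonneg by (intro sum_le_suminf) auto
  finally have h_part: "(1 - a) * S \<le> (\<Sum>n. norm (taylor_coeff h (Suc n)) * \<phi> (Suc n) r)" .
  have g_part: "(\<Sum>n. norm (taylor_coeff g (Suc n)) * \<phi> (Suc n) r)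
      = k * (\<Sum>n. norm (taylor_coeff h (Suc n)) * \<phi> (Suc n) r)"
    using k suminf_mult[OF conjunct1[OF summ], of k] by (simp add: g_coeff norm_mult mult.assoc)
  have "1 = 1 - p * (1 - a) / a + (1 - a) * (p / a)"
    by simp
  also have "\<dots> < a powr p + (1 - a) * ((1 + k) * S)"
    using a a' p tangent_le_powr[of a p] by (intro add_le_less_mono mult_strict_left_mono) auto
  also have "\<dots> = a powr p + (1 + k) * ((1 - a) * S)" by simp
  also have "\<dots> \<le> a powr p + (1 + k) * (\<Sum>n. norm (taylor_coeff h (Suc n)) * \<phi> (Suc n) r)"
    using h_part k by (intro add_left_mono mult_left_mono) auto
  also have "\<dots> = bohr_sum p \<phi> h g r"
    unfolding bohr_sum_def g_part using a'
    by (simp add: h_def taylor_coeff_extremal(1)[OF M] algebra_simps)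
  finally show ?thesis
    using hc t(3) by (auto simp: h_def)
qed

theorem theorem2:
  fixes p k R :: real and \<phi> :: "nat \<Rightarrow> real \<Rightarrow> real"
  assumes "0 < p" "p \<le> 1"
    and "0 \<le> k" "k \<le> 1"
    and "\<phi> \<in> class_F_dec"
    and "\<forall>r\<in>{0..<1}. \<phi> 0 r = 1"
    and "minimal_positive_root p (\<lambda>x. (1 + k) * Phi1 \<phi> x) R"
    and "\<forall>r\<in>{0..R}. (1 + k) * Phi1 \<phi> r \<le> p"
  shows
    "(\<forall>f h g. harmonic_class k f h g \<longrightarrow> (\<forall>r\<in>{0..<1}. bohr_summable \<phi> h g r)) \<and>
     (\<forall>f h g. harmonic_class k f h g \<longrightarrow>
        (\<forall>r\<in>{0..R}. bohr_sum p \<phi> h g r \<le> 1 \<and>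
                     (disc_supnorm h = 1 \<longrightarrow> bohr_sum p \<phi> h g r \<le> disc_supnorm h))) \<and>
     ((\<exists>\<epsilon>>0. R + \<epsilon> \<le> 1 \<and> (\<forall>x\<in>{R<..<R + \<epsilon>}. p < (1 + k) * Phi1 \<phi> x)) \<longrightarrow>
        \<not> (\<exists>R'>R. \<forall>f h g. harmonic_class k f h g \<and> disc_supnorm h = 1 \<longrightarrow>
              (\<forall>r\<in>{0..<1}. r \<le> R' \<longrightarrow> bohr_sum p \<phi> h g r \<le> disc_supnorm h)))"
proof (intro conjI allI impI ballI)
  fix f h g r
  assume "harmonic_class k f h g" "r \<in> {0..<1::real}"
  then show "bohr_summable \<phi> h g r"
    using harmonic_class_series(1) assms by blast
next
  have R: "0 < R" "R < 1"
    using assms(7) by (auto simp: minimal_positive_root_def)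
  fix f h g r
  assume fhg: "harmonic_class k f h g" and r: "r \<in> {0..R}"
  let ?a = "norm (taylor_coeff h 0)"
  have "norm (taylor_coeff h 1) \<le> 1 - ?a"
    using fhg by (auto simp: harmonic_class_def class_B'_def)
  then have a: "0 \<le> 1 - ?a" using norm_ge_zero order_trans by blast
  have "bohr_sum p \<phi> h g r \<le> ?a powr p + (1 - ?a) * ((1 + k) * Phi1 \<phi> r)"
    using harmonic_class_series(2)[OF assms(3,5) fhg] r R by auto
  also have "\<dots> \<le> (1 - p * (1 - ?a)) + (1 - ?a) * p"
    using assms(1,2,8) r a by (intro add_mono powr_le_tangent_at_1 mult_left_mono) auto
  finally show "bohr_sum p \<phi> h g r \<le> 1" by (simp add: mult.commute)
  then show "bohr_sum p \<phi> h g r \<le> disc_supnorm h" if "disc_supnorm h = 1"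
    using that by simp
next
  have R: "0 < R" "R < 1"
    using assms(7) by (auto simp: minimal_positive_root_def)
  assume "\<exists>\<epsilon>>0. R + \<epsilon> \<le> 1 \<and> (\<forall>x\<in>{R<..<R + \<epsilon>}. p < (1 + k) * Phi1 \<phi> x)"
  then obtain \<epsilon> where \<epsilon>: "0 < \<epsilon>" "R + \<epsilon> \<le> 1"
    and large: "\<And>x. R < x \<Longrightarrow> x < R + \<epsilon> \<Longrightarrow> p < (1 + k) * Phi1 \<phi> x"
    by auto
  show "\<not> (\<exists>R'>R. \<forall>f h g. harmonic_class k f h g \<and> disc_supnorm h = 1 \<longrightarrow>
              (\<forall>r\<in>{0..<1}. r \<le> R' \<longrightarrow> bohr_sum p \<phi> h g r \<le> disc_supnorm h))"
  proof
    assume "\<exists>R'>R. \<forall>f h g. harmonic_class k f h g \<and> disc_supnorm h = 1 \<longrightarrow>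
              (\<forall>r\<in>{0..<1}. r \<le> R' \<longrightarrow> bohr_sum p \<phi> h g r \<le> disc_supnorm h)"
    then obtain R' where R': "R < R'"
      and bound: "\<And>f h g r. harmonic_class k f h g \<Longrightarrow> disc_supnorm h = 1 \<Longrightarrow> r \<in> {0..<1} \<Longrightarrow>
                   r \<le> R' \<Longrightarrow> bohr_sum p \<phi> h g r \<le> disc_supnorm h"
      by blast
    obtain r where r: "R < r" "r < min R' (R + \<epsilon>)"
      using dense[of R "min R' (R + \<epsilon>)"] R' \<epsilon> by auto
    then have r01: "r \<in> {0..<1}" using R \<epsilon> by auto
    obtain f h g where "harmonic_class k f h g" "disc_supnorm h = 1" "1 < bohr_sum p \<phi> h g r"
      using ex_bohr_sum_gt_1[OF assms(1,3,5) r01 large] r by auto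
    then show False
      using bound[of f h g r] r01 r by auto
  qed
qed

end
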